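(* Let $d=2$, $\Omega=[0,1]^2$, $K(\xi)=\xi_1^{2k_1}\xi_2^{2k_2}$ with positive integers $k_1,k_2$, and let $\varphi$ be the probability density on $\Omega$ with $\varphi(\xi)\propto\xi_1^{h_1}\xi_2^{h_2}$, $h_1,h_2\in\mathbb{N}$. For a probability measure $\rho\ll\varphi$ on $\Omega$ put $$\Psi_n(\rho)=-\Big[\int_\Omega nK(\xi)\,\rho(d\xi)+D(\rho\,\|\,\varphi)\Big],$$ and let $\mathrm{ELBO}(\mathcal{F}_{\mathrm{MF}})=\sup\{\Psi_n(\rho_1\otimes\rho_2):\ \rho_1\otimes\rho_2\ll\varphi,\ \rho_1,\rho_2\text{ probability measures on }[0,1]\}$. Let $\lambda=\min\{(h_1+1)/(2k_1),(h_2+1)/(2k_2)\}$. Then $$\mathrm{ELBO}(\mathcal{F}_{\mathrm{MF}})=-\lambda\log n+O(1),$$ i.e. there is a constant $C$ independent of $n$ such that $|\mathrm{ELBO}(\mathcal{F}_{\mathrm{MF}})+\lambda\log n|\le C$ for all $n\ge1$.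
   Context: $\mathbb{N}$ includes $0$. $D(\mu\,\|\,\nu)=\mathbb{E}_\mu\log(d\mu/d\nu)$ is the Kullback--Leibler divergence. $\mathcal{F}_{\mathrm{MF}}$ is the mean-field family of product probability measures on $\Omega$ absolutely continuous with respect to $\varphi$. The number $\lambda$ is the real log canonical threshold (RLCT) of this normal form. *)

theory Defs
  imports "HOL-Probability.Probability"
begin

(* The plane is rendered as real \<times> real, so that \<rho>1 \<otimes> \<rho>2 is the library
   product measure \<rho>1 \<Otimes>\<^sub>M \<rho>2. *)
definition unit_square :: "(real \<times> real) set" where
  "unit_square = {0..1} \<times> {0..1}"

definition K_nf :: "nat \<Rightarrow> nat \<Rightarrow> real \<times> real \<Rightarrow> real" where
  "K_nf k1 k2 \<xi> = fst \<xi> ^ (2 * k1) * snd \<xi> ^ (2 * k2)"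

definition prior_density :: "nat \<Rightarrow> nat \<Rightarrow> real \<times> real \<Rightarrow> real" where
  "prior_density h1 h2 \<xi> =
     fst \<xi> ^ h1 * snd \<xi> ^ h2
       / (LINT \<eta>|restrict_space lborel unit_square. fst \<eta> ^ h1 * snd \<eta> ^ h2)"

definition prior :: "nat \<Rightarrow> nat \<Rightarrow> (real \<times> real) measure" where
  "prior h1 h2 =
     density (restrict_space lborel unit_square) (\<lambda>\<xi>. ennreal (prior_density h1 h2 \<xi>))"

(* D(\<mu> || \<nu>) with natural logarithm; the library's KL_divergence b \<nu> \<mu> is the Bochner
   integral of log b (d\<mu>/d\<nu>) against \<mu>, which is 0 when that function is not integrable.
   For probability measures \<mu> << \<nu> the negative part of ln (d\<mu>/d\<nu>) is always \<mu>-integrable,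
   so failure of integrability means exactly that the expectation is +\<infinity>. *)
definition KL_div :: "'a measure \<Rightarrow> 'a measure \<Rightarrow> ereal" where
  "KL_div \<mu> \<nu> =
     (if absolutely_continuous \<nu> \<mu> \<and> integrable \<mu> (entropy_density (exp 1) \<nu> \<mu>)
      then ereal (KL_divergence (exp 1) \<nu> \<mu>) else \<infinity>)"

definition Psi :: "(real \<times> real \<Rightarrow> real) \<Rightarrow> (real \<times> real) measure \<Rightarrow> nat
    \<Rightarrow> (real \<times> real) measure \<Rightarrow> ereal" where
  "Psi K \<phi> n \<rho> = - (ereal (LINT \<xi>|\<rho>. real n * K \<xi>) + KL_div \<rho> \<phi>)"

definition prob_measures_on :: "real set \<Rightarrow> real measure set" where
  "prob_measures_on A = {\<rho>. prob_space \<rho> \<and> sets \<rho> = sets (restrict_space borel A)}"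

definition mean_field :: "(real \<times> real) measure \<Rightarrow> (real \<times> real) measure set" where
  "mean_field \<phi> =
     {\<rho>1 \<Otimes>\<^sub>M \<rho>2 | \<rho>1 \<rho>2.
        \<rho>1 \<in> prob_measures_on {0..1} \<and> \<rho>2 \<in> prob_measures_on {0..1} \<and>
        absolutely_continuous \<phi> (\<rho>1 \<Otimes>\<^sub>M \<rho>2)}"

definition ELBO :: "(real \<times> real \<Rightarrow> real) \<Rightarrow> (real \<times> real) measure \<Rightarrow> nat
    \<Rightarrow> (real \<times> real) measure set \<Rightarrow> ereal" where
  "ELBO K \<phi> n F = (SUP \<rho>\<in>F. Psi K \<phi> n \<rho>)"

end

(* The prior is a product of the densities (h + 1) x^h on [0,1].  Upper bound: for \<rho> = \<rho>1 \<otimes> \<rho>2 the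
   expectation of K factors as A1 A2 with A_i = E x_i^(2 k_i), and the Gibbs variational principle
   with test function - x1^(2 k1) / A1 - x2^(2 k2) / A2 gives
   D(\<rho> || \<phi>) \<ge> - \<lambda>1 ln A1 - \<lambda>2 ln A2 - c \<ge> - \<lambda> ln (A1 A2) - c, as A_i \<le> 1.  It remains to minimise
   t - \<lambda> ln t over t = n A1 A2.  Lower bound: condition the prior on the strip x_i \<le> n^(-1/(2 k_i))
   for the index i attaining the minimum \<lambda>. *)
theory Submission
  imports Defs
begin

section \<open>Products of restricted Borel and Lebesgue spaces\<close>

text \<open>One inclusion needs checking only on rectangles. For the other, the identity is Borel
  measurable on the product because both coordinates are, which is where second countability
  enters.\<close>

lemma sets_pair_restrict_borel:
  fixes A :: "'a::second_countable_topology set" and B :: "'b::second_countable_topology set"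
  shows "sets (restrict_space borel A \<Otimes>\<^sub>M restrict_space borel B) = sets (restrict_space borel (A \<times> B))"
proof
  show "sets (restrict_space borel A \<Otimes>\<^sub>M restrict_space borel B) \<subseteq> sets (restrict_space borel (A \<times> B))"
  proof (rule sets_pair_in_sets)
    fix a b assume "a \<in> sets (restrict_space borel A)" "b \<in> sets (restrict_space borel B)"
    then obtain a' b' where "a = A \<inter> a'" "b = B \<inter> b'" "a' \<in> sets borel" "b' \<in> sets borel"
      by (auto simp: sets_restrict_space)
    then have "a \<times> b = (A \<times> B) \<inter> (a' \<times> b')" "a' \<times> b' \<in> sets borel"
      by (auto intro: borel_Times)
    then show "a \<times> b \<in> sets (restrict_space borel (A \<times> B))"
      by (simp add: sets_restrict_space)
  qed
next
  show "sets (restrict_space borel (A \<times> B)) \<subseteq> sets (restrict_space borel A \<Otimes>\<^sub>M restrict_space borel B)"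
    (is "_ \<subseteq> sets ?P")
  proof
    fix X assume "X \<in> sets (restrict_space borel (A \<times> B))"
    then obtain Y where Y: "X = (A \<times> B) \<inter> Y" "Y \<in> sets borel" by (auto simp: sets_restrict_space)
    have [measurable]: "fst \<in> borel_measurable ?P" "snd \<in> borel_measurable ?P"
      by (auto intro!: measurable_compose[OF measurable_fst] measurable_compose[OF measurable_snd]
          measurable_restrict_space1)
    have "(\<lambda>x. (fst x, snd x)) \<in> borel_measurable ?P"
      by (rule borel_measurable_Pair) measurable
    from measurable_sets[OF this Y(2)] have "Y \<inter> space ?P \<in> sets ?P" by (simp add: vimage_def)
    also have "Y \<inter> space ?P = X" using Y by (auto simp: space_pair_measure space_restrict_space)
    finally show "X \<in> sets ?P" .
  qed
qed

text \<open>Both measures agree on rectangles, which determines a product of sigma-finite measures.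
  This splits the base measure of the prior on the square into its two coordinates.\<close>

lemma pair_measure_restrict_lborel:
  fixes A :: "'a::euclidean_space set" and B :: "'b::euclidean_space set"
  assumes A: "A \<in> sets borel" and B: "B \<in> sets borel"
  shows "restrict_space lborel A \<Otimes>\<^sub>M restrict_space lborel B = restrict_space lborel (A \<times> B)"
proof (rule pair_measure_eqI)
  show "sigma_finite_measure (restrict_space lborel A)" "sigma_finite_measure (restrict_space lborel B)"
    using A B by (auto intro!: sigma_finite_measure_restrict_space lborel.sigma_finite_measure_axioms)
  show "sets (restrict_space lborel A \<Otimes>\<^sub>M restrict_space lborel B) = sets (restrict_space lborel (A \<times> B))"
    using sets_pair_restrict_borel[of A B]
    by (metis sets_lborel sets_pair_measure_cong sets_restrict_space_cong)
  fix a b assume "a \<in> sets (restrict_space lborel A)" "b \<in> sets (restrict_space lborel B)"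
  then have ab: "a \<subseteq> A" "b \<subseteq> B" "a \<in> sets borel" "b \<in> sets borel"
    using A B by (auto simp: sets_restrict_space_iff)
  have "A \<times> B \<in> sets borel" using A B by (rule borel_Times)
  with A B ab show "emeasure (restrict_space lborel A) a * emeasure (restrict_space lborel B) b =
      emeasure (restrict_space lborel (A \<times> B)) (a \<times> b)"
    by (simp add: emeasure_restrict_space Sigma_mono lborel.emeasure_pair_measure_Times flip: lborel_prod)
qed

section \<open>The prior as a product of one-dimensional laws\<close>

text \<open>This is the Beta(h + 1, 1) law, with its normalising constant written out.\<close>

definition power_prior :: "nat \<Rightarrow> real measure" where
  "power_prior h = density (restrict_space lborel {0..1}) (\<lambda>x. ennreal ((real h + 1) * x ^ h))"

lemma sets_power_prior [measurable_cong]: "sets (power_prior h) = sets (restrict_space borel {0..1})"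
  by (simp add: power_prior_def cong: sets_restrict_space_cong)

lemma space_power_prior [simp]: "space (power_prior h) = {0..1}"
  by (simp add: power_prior_def space_restrict_space)

lemma nn_integral_power_prior:
  assumes [measurable]: "f \<in> borel_measurable borel"
  shows "(\<integral>\<^sup>+x. f x \<partial>power_prior h) =
    (\<integral>\<^sup>+x. ennreal ((real h + 1) * x ^ h) * f x * indicator {0..1} x \<partial>lborel)"
proof -
  have [measurable]: "f \<in> borel_measurable (restrict_space lborel {0..1})"
    by (rule measurable_restrict_space1) simp
  have [measurable]: "(\<lambda>x. x) \<in> borel_measurable (restrict_space lborel {0..1::real})"
    by (rule measurable_restrict_space1) simp
  show ?thesis
    unfolding power_prior_def
    by (subst nn_integral_density) (auto simp: nn_integral_restrict_space)
qed

text \<open>The distribution function, from the antiderivative \<open>x ^ (h + 1)\<close>. It serves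
  three times: \<open>s = 1\<close> gives total mass one, \<open>s = 0\<close> shows that the origin
  is not an atom, and general \<open>s\<close> normalises the conditioned prior of the lower
  bound.\<close>

lemma emeasure_power_prior_atMost:
  assumes "0 \<le> s" "s \<le> 1"
  shows "emeasure (power_prior h) {0..s} = ennreal (s ^ (h + 1))"
proof -
  have "emeasure (power_prior h) {0..s} = (\<integral>\<^sup>+x. indicator {0..s} x \<partial>power_prior h)"
    using assms by (intro nn_integral_indicator[symmetric])
      (auto simp: sets_power_prior sets_restrict_space_iff)
  also have "\<dots> = (\<integral>\<^sup>+x. ennreal ((real h + 1) * x ^ h) * indicator {0..s} x \<partial>lborel)"
    using assms by (subst nn_integral_power_prior)
      (auto intro!: nn_integral_cong simp: indicator_def)
  also have "\<dots> = ennreal (s ^ (h + 1) - 0 ^ (h + 1))"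
    using assms
    using DERIV_pow[of "Suc h"]
    by (intro nn_integral_FTC_Icc) (auto simp: add.commute mult.commute)
  finally show ?thesis by simp
qed

lemma prob_space_power_prior: "prob_space (power_prior h)"
  by (rule prob_spaceI) (use emeasure_power_prior_atMost[of 1 h] in simp)

lemma nn_integral_pair_mult:
  assumes "sigma_finite_measure M" "sigma_finite_measure N"
  assumes [measurable]: "f \<in> borel_measurable M" "g \<in> borel_measurable N"
  shows "(\<integral>\<^sup>+z. f (fst z) * g (snd z) \<partial>(M \<Otimes>\<^sub>M N)) = (\<integral>\<^sup>+x. f x \<partial>M) * (\<integral>\<^sup>+x. g x \<partial>N)"
proof -
  interpret N: sigma_finite_measure N by fact
  show ?thesis
    by (subst N.nn_integral_fst[symmetric]) (auto simp: nn_integral_cmult nn_integral_multc)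
qed

lemma prior_eq_pair: "prior h1 h2 = power_prior h1 \<Otimes>\<^sub>M power_prior h2"
proof -
  let ?R = "restrict_space lborel {0..1::real}"
  define c where "c = (real h1 + 1) * (real h2 + 1)"
  have c: "c > 0" by (simp add: c_def add_pos_nonneg)
  have sq: "restrict_space lborel unit_square = ?R \<Otimes>\<^sub>M ?R"
    unfolding unit_square_def by (rule pair_measure_restrict_lborel[symmetric]) auto
  have [measurable]: "(\<lambda>x. x) \<in> borel_measurable ?R"
    by (rule measurable_restrict_space1) simp
  have sfR: "sigma_finite_measure ?R"
    by (auto intro!: sigma_finite_measure_restrict_space lborel.sigma_finite_measure_axioms)
  interpret P2: prob_space "power_prior h2" by (rule prob_space_power_prior)
  interpret P: pair_prob_space "power_prior h1" "power_prior h2"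
    by (simp add: pair_prob_space_def pair_sigma_finite_def prob_space_power_prior
        prob_space.axioms(1) finite_measure.axioms(1) prob_space_imp_sigma_finite)
  have [measurable]: "fst \<in> borel_measurable (?R \<Otimes>\<^sub>M ?R)" "snd \<in> borel_measurable (?R \<Otimes>\<^sub>M ?R)"
    by (auto intro!: measurable_compose[OF measurable_fst] measurable_compose[OF measurable_snd])
  have pair: "power_prior h1 \<Otimes>\<^sub>M power_prior h2 =
    density (?R \<Otimes>\<^sub>M ?R) (\<lambda>(x, y). ennreal ((real h1 + 1) * x ^ h1) * ennreal ((real h2 + 1) * y ^ h2))"
    unfolding power_prior_def
  proof (rule pair_measure_density)
    show "sigma_finite_measure (density ?R (\<lambda>x. ennreal ((real h2 + 1) * x ^ h2)))"
      using P2.sigma_finite_measure_axioms by (simp add: power_prior_def)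
  qed (use sfR in auto)
  also have "\<dots> = density (?R \<Otimes>\<^sub>M ?R) (\<lambda>z. ennreal (c * (fst z ^ h1 * snd z ^ h2)))"
    by (intro density_cong)
      (auto simp: c_def space_pair_measure space_restrict_space ac_simps simp flip: ennreal_mult)
  finally have eq: "power_prior h1 \<Otimes>\<^sub>M power_prior h2 = \<dots>" .
  \<comment> \<open>The normalising integral inside \<open>prior_density\<close> is read off from
    the total mass of the product: it must equal \<open>1 / c\<close>.\<close>
  have "1 = emeasure (power_prior h1 \<Otimes>\<^sub>M power_prior h2) (space (power_prior h1 \<Otimes>\<^sub>M power_prior h2))"
    by (rule P.emeasure_space_1[symmetric])
  also have "\<dots> = (\<integral>\<^sup>+z. ennreal (c * (fst z ^ h1 * snd z ^ h2)) \<partial>(?R \<Otimes>\<^sub>M ?R))"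
    unfolding eq by (simp add: emeasure_density cong: nn_integral_cong)
  finally have one: "(\<integral>\<^sup>+z. ennreal (c * (fst z ^ h1 * snd z ^ h2)) \<partial>(?R \<Otimes>\<^sub>M ?R)) = ennreal 1"
    by simp
  have "(LINT z|(?R \<Otimes>\<^sub>M ?R). c * (fst z ^ h1 * snd z ^ h2)) = 1"
    using one c by (subst integral_eq_nn_integral)
      (auto simp: space_pair_measure space_restrict_space intro!: AE_I2)
  then have "c * (LINT z|restrict_space lborel unit_square. fst z ^ h1 * snd z ^ h2) = 1"
    by (simp add: sq)
  then have "(LINT z|restrict_space lborel unit_square. fst z ^ h1 * snd z ^ h2) = 1 / c"
    using c by (simp add: field_simps)
  then have "prior_density h1 h2 = (\<lambda>z. c * (fst z ^ h1 * snd z ^ h2))"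
    by (simp add: prior_density_def fun_eq_iff mult.commute)
  then show ?thesis
    by (simp add: prior_def sq eq)
qed

section \<open>Relative entropy: the Gibbs inequality and conditioned measures\<close>

text \<open>With \<open>D\<close> the density of \<open>N\<close> with respect to \<open>M\<close>,
  integrate \<open>ln r \<le> r - 1\<close> against \<open>N\<close> for
  \<open>r = exp (g - L) / D\<close>. The bound on the exponential integral makes the mean of
  \<open>r\<close> at most 1, so the right-hand side contributes nothing positive.\<close>

lemma gibbs_variational:
  assumes M: "sigma_finite_measure M" and N: "prob_space N"
    and ac: "absolutely_continuous M N" and sets: "sets N = sets M"
    and int: "integrable N (entropy_density (exp 1) M N)"
    and g: "integrable N g"
    and le: "(\<integral>\<^sup>+x. ennreal (exp (g x)) \<partial>M) \<le> ennreal (exp L)"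
  shows "(LINT x|N. g x) - L \<le> KL_divergence (exp 1) M N"
proof -
  interpret M: sigma_finite_measure M by fact
  interpret N: prob_space N by fact
  obtain D where D: "D \<in> borel_measurable M" "AE x in M. RN_deriv M N x = ennreal (D x)"
    "AE x in N. 0 < D x" "\<And>x. 0 \<le> D x"
    using M.real_RN_deriv[OF N.finite_measure_axioms ac sets] by metis
  have [measurable]: "D \<in> borel_measurable M" "D \<in> borel_measurable N"
    using D(1) sets by (simp_all cong: measurable_cong_sets)
  have [measurable]: "g \<in> borel_measurable N" using g by simp
  then have [measurable]: "g \<in> borel_measurable M" using sets by (simp cong: measurable_cong_sets)
  have N_eq: "N = density M (\<lambda>x. ennreal (D x))"
  proof -
    have "N = density M (RN_deriv M N)" by (rule M.density_RN_deriv[OF ac sets, symmetric])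
    also have "\<dots> = density M (\<lambda>x. ennreal (D x))" using D(2) by (intro density_cong) auto
    finally show ?thesis .
  qed
  let ?r = "\<lambda>x. exp (g x - L) / D x"
  have "(\<integral>\<^sup>+x. ennreal (?r x) \<partial>N) = (\<integral>\<^sup>+x. ennreal (D x) * ennreal (?r x) \<partial>M)"
    by (subst N_eq, rule nn_integral_density) auto
  also have "\<dots> \<le> (\<integral>\<^sup>+x. ennreal (exp (g x)) * ennreal (exp (- L)) \<partial>M)"
  proof (rule nn_integral_mono)
    fix x
    \<comment> \<open>Division by zero yields 0, so the left side vanishes where
      \<open>D x = 0\<close>; in general this is an inequality, and that direction suffices.\<close>
    have "D x * ?r x \<le> exp (g x) * exp (- L)"
      by (cases "D x = 0") (auto simp: exp_diff exp_minus field_simps)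
    then show "ennreal (D x) * ennreal (?r x) \<le> ennreal (exp (g x)) * ennreal (exp (- L))"
      using D(4)[of x] by (simp flip: ennreal_mult add: ennreal_leI)
  qed
  also have "\<dots> = (\<integral>\<^sup>+x. ennreal (exp (g x)) \<partial>M) * ennreal (exp (- L))"
    by (rule nn_integral_multc) auto
  also have "\<dots> \<le> ennreal (exp L) * ennreal (exp (- L))"
    using le by (rule mult_right_mono) simp
  also have "\<dots> = ennreal 1" by (simp flip: ennreal_mult exp_add)
  finally have r: "(\<integral>\<^sup>+x. ennreal (?r x) \<partial>N) \<le> ennreal 1" .
  have r_int: "integrable N ?r"
    using r D(4) by (intro integrableI_nonneg) (auto simp: le_less_trans)
  have r_le: "(LINT x|N. ?r x) \<le> 1"
    using r by (intro integral_real_bounded) auto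
  have ed: "AE x in N. entropy_density (exp 1) M N x = ln (D x)"
    using absolutely_continuous_AE[OF sets ac D(2)] D(4)
    by (auto simp: entropy_density_def log_def)
  have "(LINT x|N. g x - L + 1 - ?r x) \<le> KL_divergence (exp 1) M N"
    unfolding KL_divergence_def
  proof (rule integral_mono_AE)
    show "AE x in N. g x - L + 1 - ?r x \<le> entropy_density (exp 1) M N x"
      using ed D(3)
    proof eventually_elim
      case (elim x)
      have "ln (?r x) \<le> ?r x - 1" using elim by (intro ln_le_minus_one) auto
      moreover have "ln (?r x) = g x - L - ln (D x)" using elim by (simp add: ln_div)
      ultimately show ?case using elim by simp
    qed
  qed (use g int r_int in auto)
  moreover have "(LINT x|N. g x - L + 1 - ?r x) = (LINT x|N. g x) - L + 1 - (LINT x|N. ?r x)"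
    using g r_int by (simp add: N.prob_space)
  ultimately show ?thesis using r_le by simp
qed

text \<open>Total mass one forces \<open>c\<close> to be the inverse of the \<open>M\<close>-mass of
  \<open>B\<close>, so the measure is \<open>M\<close> conditioned on \<open>B\<close>. Its
  log-density is almost everywhere the constant \<open>ln c\<close>, hence integrable, and the
  finite branch of \<open>KL_div\<close> applies.\<close>

lemma KL_div_density_indicator:
  assumes M: "sigma_finite_measure M" and B: "B \<in> sets M" and c: "c > 0"
    and N: "prob_space (density M (\<lambda>x. ennreal c * indicator B x))" (is "prob_space ?N")
  shows "KL_div ?N M = ereal (ln c)"
proof -
  interpret M: sigma_finite_measure M by fact
  interpret N: prob_space ?N by fact
  note [measurable] = B
  have ac: "absolutely_continuous M ?N" by (rule absolutely_continuousI_density) simp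
  have "AE x in M. ennreal c * indicator B x = RN_deriv M ?N x"
    by (rule M.RN_deriv_unique) auto
  then have "AE x in ?N. entropy_density (exp 1) M ?N x = ln c"
    using c by (subst AE_density)
      (auto simp: entropy_density_def log_def indicator_def split: if_splits elim!: eventually_mono)
  moreover have [measurable]: "entropy_density (exp 1) M ?N \<in> borel_measurable ?N" by simp
  ultimately have "integrable ?N (entropy_density (exp 1) M ?N) \<longleftrightarrow> integrable ?N (\<lambda>_. ln c)"
    and "KL_divergence (exp 1) M ?N = (LINT x|?N. ln c)"
    unfolding KL_divergence_def by (intro integrable_cong_AE integral_cong_AE; simp)+
  with ac show ?thesis using N.prob_space by (simp add: KL_div_def)
qed

section \<open>Lower bound: the prior conditioned on a box\<close>

lemma pair_prob_spaceI: "prob_space M \<Longrightarrow> prob_space N \<Longrightarrow> pair_prob_space M N"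
  by (simp add: pair_prob_space_def pair_sigma_finite_def prob_space_imp_sigma_finite)

lemma sigma_finite_prior: "sigma_finite_measure (prior h1 h2)"
proof -
  interpret pair_prob_space "power_prior h1" "power_prior h2"
    by (intro pair_prob_spaceI prob_space_power_prior)
  show ?thesis unfolding prior_eq_pair by unfold_locales
qed

lemma K_nf_bounds:
  assumes "0 \<le> fst z" "fst z \<le> s1" "0 \<le> snd z" "snd z \<le> s2"
  shows "0 \<le> K_nf k1 k2 z" "K_nf k1 k2 z \<le> s1 ^ (2 * k1) * s2 ^ (2 * k2)"
  using assms by (auto simp: K_nf_def intro!: mult_mono power_mono)

text \<open>The trial measure is the prior conditioned on the box with sides \<open>s1\<close>,
  \<open>s2\<close>. Its divergence is minus the log of the prior mass
  \<open>s1 ^ (h1 + 1) * s2 ^ (h2 + 1)\<close> of the box, and \<open>K_nf\<close> is at most its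
  value at the far corner. Two free sides cover both cases of the minimum.\<close>

lemma ELBO_prior_ge:
  assumes s1: "0 < s1" "s1 \<le> 1" and s2: "0 < s2" "s2 \<le> 1"
  shows "ereal ((real h1 + 1) * ln s1 + (real h2 + 1) * ln s2 - real n * (s1 ^ (2 * k1) * s2 ^ (2 * k2)))
    \<le> ELBO (K_nf k1 k2) (prior h1 h2) n (mean_field (prior h1 h2))"
proof -
  \<comment> \<open>One factor of the trial measure: the prior conditioned on \<open>{0..s}\<close>,
    whose mass is \<open>s ^ (h + 1)\<close>.\<close>
  define q where
    "q s h = density (power_prior h) (\<lambda>x. ennreal (1 / s ^ (h + 1)) * indicator {0..s} x)" for s h
  have sets_q [measurable_cong]: "sets (q s h) = sets (restrict_space borel {0..1})" for s h
    by (simp add: q_def sets_power_prior)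
  have sets_Icc: "{0..s} \<in> sets (power_prior h)" if "s \<le> 1" for s h
    using that by (auto simp: sets_power_prior sets_restrict_space_iff)
  have prob_q: "prob_space (q s h)" if "0 < s" "s \<le> 1" for s h
  proof
    note [measurable] = sets_Icc[OF that(2)]
    have "emeasure (q s h) (space (q s h)) =
        (\<integral>\<^sup>+x. ennreal (1 / s ^ (h + 1)) * indicator {0..s} x \<partial>power_prior h)"
      unfolding q_def space_density
      by (subst emeasure_density[OF _ sets.top], measurable)
        (auto intro!: nn_integral_cong simp: indicator_def)
    also have "\<dots> = ennreal (1 / s ^ (h + 1)) * ennreal (s ^ (h + 1))"
      using that by (simp add: nn_integral_cmult emeasure_power_prior_atMost del: power_Suc)
    also have "\<dots> = 1" using that by (simp flip: ennreal_mult)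
    finally show "emeasure (q s h) (space (q s h)) = 1" .
  qed
  define c where "c = 1 / s1 ^ (h1 + 1) * (1 / s2 ^ (h2 + 1))"
  have c: "c > 0" using s1 s2 by (simp add: c_def)
  let ?P = "power_prior h1 \<Otimes>\<^sub>M power_prior h2" and ?Q = "q s1 h1 \<Otimes>\<^sub>M q s2 h2"
  let ?B = "{0..s1} \<times> {0..s2}"
  note [measurable] = sets_Icc[OF s1(2)] sets_Icc[OF s2(2)]
  have "?Q = density ?P (\<lambda>(x, y). (ennreal (1 / s1 ^ (h1 + 1)) * indicator {0..s1} x) *
      (ennreal (1 / s2 ^ (h2 + 1)) * indicator {0..s2} y))"
    unfolding q_def
  proof (rule pair_measure_density)
    show "sigma_finite_measure (density (power_prior h2)
        (\<lambda>x. ennreal (1 / s2 ^ (h2 + 1)) * indicator {0..s2} x))"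
      using prob_q[OF s2] unfolding q_def by (rule prob_space_imp_sigma_finite)
  qed (auto intro: prob_space_imp_sigma_finite prob_space_power_prior)
  also have "(\<lambda>(x, y). (ennreal (1 / s1 ^ (h1 + 1)) * indicator {0..s1} x) *
      (ennreal (1 / s2 ^ (h2 + 1)) * indicator {0..s2} y)) = (\<lambda>z. ennreal c * indicator ?B z)"
  proof -
    have "ennreal c = ennreal (1 / s1 ^ (h1 + 1)) * ennreal (1 / s2 ^ (h2 + 1))"
      unfolding c_def using s1 s2 by (intro ennreal_mult) auto
    then show ?thesis by (auto simp: fun_eq_iff indicator_def)
  qed
  finally have Q: "?Q = density ?P (\<lambda>z. ennreal c * indicator ?B z)" .
  interpret Q: pair_prob_space "q s1 h1" "q s2 h2"
    by (intro pair_prob_spaceI prob_q s1 s2)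
  have sf: "sigma_finite_measure ?P" using sigma_finite_prior by (simp add: prior_eq_pair)
  have B: "?B \<in> sets ?P" by measurable
  have KL: "KL_div ?Q (prior h1 h2) = ereal (ln c)"
    unfolding prior_eq_pair Q using Q.P.prob_space_axioms
    by (intro KL_div_density_indicator[OF sf B c]) (simp add: Q)
  have ac: "absolutely_continuous (prior h1 h2) ?Q"
    unfolding prior_eq_pair Q by (rule absolutely_continuousI_density) (use B in measurable)
  have mem: "?Q \<in> mean_field (prior h1 h2)"
    unfolding mean_field_def prob_measures_on_def
    using ac sets_q prob_q[OF s1] prob_q[OF s2] by blast
  \<comment> \<open>The space of \<open>?Q\<close> is still the whole square, so the bound on
    \<open>K_nf\<close> is available only almost everywhere.\<close>
  have inB: "AE z in ?Q. z \<in> ?B"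
    unfolding Q using B by (subst AE_density) (auto simp: indicator_def)
  have [measurable]: "fst \<in> borel_measurable ?Q" "snd \<in> borel_measurable ?Q"
    by (auto intro!: measurable_compose[OF measurable_fst] measurable_compose[OF measurable_snd]
        measurable_restrict_space1 simp: measurable_cong_sets[OF sets_q refl])
  have bd: "AE z in ?Q. 0 \<le> real n * K_nf k1 k2 z \<and>
      real n * K_nf k1 k2 z \<le> real n * (s1 ^ (2 * k1) * s2 ^ (2 * k2))"
    using inB by eventually_elim (auto intro!: mult_left_mono K_nf_bounds mult_nonneg_nonneg)
  have meas: "(\<lambda>z. real n * K_nf k1 k2 z) \<in> borel_measurable ?Q"
    unfolding K_nf_def by measurable
  have "AE z in ?Q. norm (real n * K_nf k1 k2 z) \<le> real n * (s1 ^ (2 * k1) * s2 ^ (2 * k2))"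
    using bd by eventually_elim simp
  then have "integrable ?Q (\<lambda>z. real n * K_nf k1 k2 z)"
    using meas by (rule Q.P.integrable_const_bound)
  then have "(LINT z|?Q. real n * K_nf k1 k2 z) \<le> real n * (s1 ^ (2 * k1) * s2 ^ (2 * k2))"
    using bd by (intro Q.P.integral_le_const) auto
  moreover have "ln c = - ((real h1 + 1) * ln s1 + (real h2 + 1) * ln s2)"
    using s1 s2 by (simp add: c_def ln_mult ln_div ln_realpow algebra_simps)
  ultimately have "ereal ((real h1 + 1) * ln s1 + (real h2 + 1) * ln s2
      - real n * (s1 ^ (2 * k1) * s2 ^ (2 * k2))) \<le> Psi (K_nf k1 k2) (prior h1 h2) n ?Q"
    by (simp add: Psi_def KL)
  also have "\<dots> \<le> ELBO (K_nf k1 k2) (prior h1 h2) n (mean_field (prior h1 h2))"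
    unfolding ELBO_def by (rule SUP_upper) (rule mem)
  finally show ?thesis .
qed

section \<open>Upper bound: exponential integrals and the Gibbs inequality\<close>

text \<open>What matters is the order \<open>s ^ (h + 1)\<close> with a constant independent of
  \<open>s\<close>. After extension to the half-line, the substitution \<open>x = s * u\<close>
  extracts this power and leaves \<open>fact h\<close>; the density's factor \<open>h + 1\<close>
  turns it into \<open>fact (h + 1)\<close>.\<close>

lemma nn_integral_exp_power_prior_le:
  assumes s: "s > 0" and k: "k > 0"
  shows "(\<integral>\<^sup>+x. ennreal (exp (- ((x / s) ^ k))) \<partial>power_prior h)
    \<le> ennreal (exp 1 * fact (h + 1) * s ^ (h + 1))"
proof -
  define c where "c = exp 1 * (real h + 1)"
  have c: "c \<ge> 0" by (simp add: c_def)
  have "(\<integral>\<^sup>+x. ennreal (exp (- ((x / s) ^ k))) \<partial>power_prior h) =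
    (\<integral>\<^sup>+x. ennreal ((real h + 1) * x ^ h) * ennreal (exp (- ((x / s) ^ k))) * indicator {0..1} x \<partial>lborel)"
    by (rule nn_integral_power_prior) measurable
  also have "\<dots> \<le> (\<integral>\<^sup>+x. ennreal (c * (x ^ h * exp (- (x / s)))) * indicator {0..} x \<partial>lborel)"
  proof (rule nn_integral_mono)
    fix x :: real
    show "ennreal ((real h + 1) * x ^ h) * ennreal (exp (- ((x / s) ^ k))) * indicator {0..1} x
      \<le> ennreal (c * (x ^ h * exp (- (x / s)))) * indicator {0..} x"
    proof (cases "x \<in> {0..1}")
      case True
      \<comment> \<open>\<open>u \<le> 1 + u ^ k\<close> reduces the integral to a Gamma integral.\<close>
      have "x / s \<le> 1 + (x / s) ^ k"
      proof (cases "x / s \<le> 1")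
        case True
        then show ?thesis using s \<open>x \<in> {0..1}\<close> by (simp add: add_increasing2)
      next
        case False
        then show ?thesis using self_le_power[of "x / s" k] k by auto
      qed
      then have "exp (- ((x / s) ^ k)) \<le> exp (1 - x / s)" by simp
      also have "\<dots> = exp 1 * exp (- (x / s))" by (simp flip: exp_add)
      finally have "(real h + 1) * x ^ h * exp (- ((x / s) ^ k)) \<le> (real h + 1) * x ^ h * (exp 1 * exp (- (x / s)))"
        using True by (intro mult_left_mono) auto
      then show ?thesis using True
        by (auto simp: c_def ac_simps simp flip: ennreal_mult intro!: ennreal_leI)
    qed simp
  qed
  \<comment> \<open>The Jacobian contributes one factor \<open>s\<close>, the monomial the other
    \<open>s ^ h\<close>.\<close>
  also have "\<dots> = ennreal \<bar>s\<bar> * (\<integral>\<^sup>+x. ennreal (c * ((0 + s * x) ^ h * exp (- ((0 + s * x) / s)))) * indicator {0..} (0 + s * x) \<partial>lborel)"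
    using s by (intro nn_integral_real_affine) auto
  also have "\<dots> = ennreal s * (\<integral>\<^sup>+x. ennreal (c * s ^ h) * (ennreal (x ^ h * exp (- x)) * indicator {0..} x) \<partial>lborel)"
  proof (rule arg_cong2[of _ _ _ _ "(*)"], use s in simp, rule nn_integral_cong)
    fix x :: real
    have "c * ((0 + s * x) ^ h * exp (- ((0 + s * x) / s))) = (c * s ^ h) * (x ^ h * exp (- x))"
      using s by (simp add: power_mult_distrib)
    then show "ennreal (c * ((0 + s * x) ^ h * exp (- ((0 + s * x) / s)))) * indicator {0..} (0 + s * x) =
        ennreal (c * s ^ h) * (ennreal (x ^ h * exp (- x)) * indicator {0..} x)"
      using s c by (cases "x \<ge> 0") (simp_all only: ennreal_mult, auto simp: indicator_def zero_le_mult_iff ennreal_mult)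
  qed
  also have "\<dots> = ennreal s * (ennreal (c * s ^ h) * ennreal (fact h))"
    by (subst nn_integral_cmult) (auto simp: nn_intergal_power_times_exp_Ici)
  also have "\<dots> = ennreal (exp 1 * fact (h + 1) * s ^ (h + 1))"
    using s c by (simp add: c_def algebra_simps flip: ennreal_mult)
  finally show ?thesis .
qed

text \<open>Joint integrability licenses Fubini; pulling a scalar out of a real Bochner integral is
  then unconditional, by the default value 0.\<close>

lemma integral_pair_mult:
  fixes f :: "'a \<Rightarrow> real" and g :: "'b \<Rightarrow> real"
  assumes MN: "pair_sigma_finite M N"
    and int: "integrable (M \<Otimes>\<^sub>M N) (\<lambda>z. f (fst z) * g (snd z))"
  shows "(LINT z|(M \<Otimes>\<^sub>M N). f (fst z) * g (snd z)) = (LINT x|M. f x) * (LINT y|N. g y)"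
  by (subst pair_sigma_finite.integral_fst'[OF MN int, symmetric]) simp

text \<open>The exponent is a sum over coordinates, so the integral factors over the product prior.
  This is the normalisation bound that the Gibbs inequality asks for.\<close>

lemma nn_integral_exp_prior_le:
  assumes s: "s1 > 0" "s2 > 0" and k: "k1 > 0" "k2 > 0"
  shows "(\<integral>\<^sup>+z. ennreal (exp (- ((fst z / s1) ^ k1) - (snd z / s2) ^ k2)) \<partial>prior h1 h2)
    \<le> ennreal (exp 2 * fact (h1 + 1) * fact (h2 + 1) * s1 ^ (h1 + 1) * s2 ^ (h2 + 1))"
proof -
  let ?f = "\<lambda>k s x. ennreal (exp (- ((x / s) ^ k)))"
  let ?c = "\<lambda>h s. exp 1 * fact (h + 1) * s ^ (h + 1)"
  have [measurable]: "?f k s \<in> borel_measurable (power_prior h)" for k s h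
    by (simp add: measurable_cong_sets[OF sets_power_prior refl] measurable_restrict_space1)
  have "(\<integral>\<^sup>+z. ennreal (exp (- ((fst z / s1) ^ k1) - (snd z / s2) ^ k2)) \<partial>prior h1 h2) =
      (\<integral>\<^sup>+z. ?f k1 s1 (fst z) * ?f k2 s2 (snd z) \<partial>(power_prior h1 \<Otimes>\<^sub>M power_prior h2))"
    unfolding prior_eq_pair by (simp flip: ennreal_mult exp_add)
  also have "\<dots> = (\<integral>\<^sup>+x. ?f k1 s1 x \<partial>power_prior h1) * (\<integral>\<^sup>+y. ?f k2 s2 y \<partial>power_prior h2)"
    by (intro nn_integral_pair_mult prob_space_imp_sigma_finite prob_space_power_prior) measurable
  also have "\<dots> \<le> ennreal (?c h1 s1) * ennreal (?c h2 s2)"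
    by (intro mult_mono nn_integral_exp_power_prior_le s k) auto
  also have "\<dots> = ennreal (?c h1 s1 * ?c h2 s2)" using s by (intro ennreal_mult[symmetric]) auto
  also have "?c h1 s1 * ?c h2 s2 = exp (1 + 1) * fact (h1 + 1) * fact (h2 + 1) * s1 ^ (h1 + 1) * s2 ^ (h2 + 1)"
    unfolding exp_add by (simp only: mult_ac)
  finally show ?thesis by simp
qed

text \<open>Absolute continuity carries this over to every mean-field measure, so its coordinate
  moments are positive and have logarithms.\<close>

lemma AE_prior_pos: "AE z in prior h1 h2. 0 < fst z \<and> 0 < snd z"
proof -
  have P: "AE x in power_prior h. 0 < x" for h
  proof (rule AE_I[where N = "{0}"])
    show "{x \<in> space (power_prior h). \<not> 0 < x} \<subseteq> {0}" by auto
    show "emeasure (power_prior h) {0} = 0"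
      using emeasure_power_prior_atMost[of 0 h] by simp
    show "{0} \<in> sets (power_prior h)"
      by (auto simp: sets_power_prior sets_restrict_space_iff)
  qed
  interpret pair_prob_space "power_prior h1" "power_prior h2"
    by (intro pair_prob_spaceI prob_space_power_prior)
  have [measurable]: "fst \<in> borel_measurable (power_prior h1 \<Otimes>\<^sub>M power_prior h2)"
    "snd \<in> borel_measurable (power_prior h1 \<Otimes>\<^sub>M power_prior h2)"
    by (auto intro!: measurable_compose[OF measurable_fst] measurable_compose[OF measurable_snd]
        measurable_restrict_space1 simp: measurable_cong_sets[OF sets_power_prior refl])
  show ?thesis
    unfolding prior_eq_pair
  proof (rule AE_pair_measure)
    show "AE x in power_prior h1. AE y in power_prior h2. 0 < fst (x, y) \<and> 0 < snd (x, y)"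
      using P[of h1] by eventually_elim (use P[of h2] in simp)
  qed measurable
qed

text \<open>The minimum of \<open>t - lam * ln t\<close> is attained at \<open>t = lam\<close>; this
  is \<open>ln u \<le> u - 1\<close> at \<open>u = t / lam\<close>.\<close>

lemma diff_mult_ln_ge:
  fixes lam t :: real
  assumes "lam > 0" "t > 0"
  shows "lam - lam * ln lam \<le> t - lam * ln t"
proof -
  have "ln (t / lam) \<le> t / lam - 1" using assms by (intro ln_le_minus_one) auto
  then have "lam * ln (t / lam) \<le> lam * (t / lam - 1)" using assms by (intro mult_left_mono) auto
  then show ?thesis using assms by (simp add: ln_div algebra_simps)
qed

text \<open>The bound is uniform over the family. In the constant 4, one 2 comes from the mean -2 of
  the test function and the other from the factor \<open>exp 2\<close> in its exponential
  integral.\<close>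

lemma Psi_mean_field_le:
  fixes k1 k2 h1 h2 n :: nat
  assumes k: "k1 > 0" "k2 > 0" and n: "n \<ge> 1"
    and lam: "lam > 0" "lam \<le> (real h1 + 1) / (2 * real k1)" "lam \<le> (real h2 + 1) / (2 * real k2)"
    and \<rho>: "\<rho> \<in> mean_field (prior h1 h2)"
  shows "Psi (K_nf k1 k2) (prior h1 h2) n \<rho>
    \<le> ereal (4 + ln (fact (h1 + 1)) + ln (fact (h2 + 1)) - lam + lam * ln lam - lam * ln (real n))"
proof (cases "absolutely_continuous (prior h1 h2) \<rho> \<and>
    integrable \<rho> (entropy_density (exp 1) (prior h1 h2) \<rho>)")
  \<comment> \<open>Infinite divergence makes \<open>Psi\<close> equal to minus infinity.\<close>
  case False
  then have "KL_div \<rho> (prior h1 h2) = \<infinity>" unfolding KL_div_def by (rule if_not_P)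
  then show ?thesis by (simp add: Psi_def)
next
  case True
  from \<rho> obtain \<rho>1 \<rho>2 where eq: "\<rho> = \<rho>1 \<Otimes>\<^sub>M \<rho>2"
    and prob: "prob_space \<rho>1" "prob_space \<rho>2"
    and sets12: "sets \<rho>1 = sets (restrict_space borel {0..1})" "sets \<rho>2 = sets (restrict_space borel {0..1})"
    by (auto simp: mean_field_def prob_measures_on_def)
  interpret R: pair_prob_space \<rho>1 \<rho>2 by (intro pair_prob_spaceI prob)
  have prob_\<rho>: "prob_space \<rho>" unfolding eq by (rule R.P.prob_space_axioms)
  interpret \<rho>: prob_space \<rho> by (rule prob_\<rho>)
  have sets_eq: "sets \<rho> = sets (prior h1 h2)"
    unfolding eq prior_eq_pair by (intro sets_pair_measure_cong) (simp_all add: sets12 sets_power_prior)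
  have [measurable]: "fst \<in> borel_measurable \<rho>" "snd \<in> borel_measurable \<rho>"
    unfolding eq
    by (auto intro!: measurable_compose[OF measurable_fst] measurable_compose[OF measurable_snd]
        measurable_restrict_space1
        simp: measurable_cong_sets[OF sets12(1) refl] measurable_cong_sets[OF sets12(2) refl])
  have space_\<rho>: "space \<rho> = {0..1} \<times> {0..1}"
    using sets_eq_imp_space_eq[OF sets_eq] by (simp add: prior_eq_pair space_pair_measure)
  have pos: "AE z in \<rho>. 0 < fst z \<and> 0 < snd z"
    using absolutely_continuous_AE[OF sets_eq conjunct1[OF True] AE_prior_pos] .
  define A1 where "A1 = (LINT z|\<rho>. fst z ^ (2 * k1))"
  define A2 where "A2 = (LINT z|\<rho>. snd z ^ (2 * k2))"
  have int1: "integrable \<rho> (\<lambda>z. fst z ^ (2 * k1))"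
    by (rule \<rho>.integrable_const_bound[where B = 1]) (auto simp: space_\<rho> power_le_one)
  have int2: "integrable \<rho> (\<lambda>z. snd z ^ (2 * k2))"
    by (rule \<rho>.integrable_const_bound[where B = 1]) (auto simp: space_\<rho> power_le_one)
  have int12: "integrable \<rho> (\<lambda>z. fst z ^ (2 * k1) * snd z ^ (2 * k2))"
    by (rule \<rho>.integrable_const_bound[where B = 1]) (auto simp: space_\<rho> power_le_one mult_le_one)
  have A_le: "A1 \<le> 1" "A2 \<le> 1"
    unfolding A1_def A2_def using int1 int2
    by (auto intro!: \<rho>.integral_le_const simp: space_\<rho> power_le_one)
  \<comment> \<open>A vanishing moment would concentrate \<rho> on a coordinate axis, contrary to
    \<open>pos\<close>.\<close>
  have "A1 \<noteq> 0"
  proof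
    assume "A1 = 0"
    then have "AE z in \<rho>. fst z ^ (2 * k1) = 0"
      unfolding A1_def by (subst (asm) integral_nonneg_eq_0_iff_AE[OF int1]) auto
    with pos have "AE z in \<rho>. False" by eventually_elim simp
    then show False by simp
  qed
  moreover have "A2 \<noteq> 0"
  proof
    assume "A2 = 0"
    then have "AE z in \<rho>. snd z ^ (2 * k2) = 0"
      unfolding A2_def by (subst (asm) integral_nonneg_eq_0_iff_AE[OF int2]) auto
    with pos have "AE z in \<rho>. False" by eventually_elim simp
    then show False by simp
  qed
  moreover have "0 \<le> A1" "0 \<le> A2"
    unfolding A1_def A2_def by (intro integral_nonneg_AE; simp)+
  ultimately have A_pos: "0 < A1" "0 < A2" by auto
  \<comment> \<open>Independence of the coordinates enters here: the mean of \<open>K_nf\<close> is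
    the product of the two moments. Pairing with the constant function 1 identifies each marginal
    moment with its joint form.\<close>
  have K: "(LINT z|\<rho>. real n * K_nf k1 k2 z) = real n * (A1 * A2)"
  proof -
    have "(LINT z|\<rho>. K_nf k1 k2 z) = (LINT x|\<rho>1. x ^ (2 * k1)) * (LINT y|\<rho>2. y ^ (2 * k2))"
      using integral_pair_mult[OF R.pair_sigma_finite_axioms int12[unfolded eq]]
      by (simp add: K_nf_def eq)
    also have "(LINT x|\<rho>1. x ^ (2 * k1)) = A1"
      using integral_pair_mult[OF R.pair_sigma_finite_axioms, of "\<lambda>x. x ^ (2 * k1)" "\<lambda>_. 1"] int1
      by (simp add: A1_def eq R.M2.prob_space)
    also have "(LINT y|\<rho>2. y ^ (2 * k2)) = A2"
      using integral_pair_mult[OF R.pair_sigma_finite_axioms, of "\<lambda>_. 1" "\<lambda>y. y ^ (2 * k2)"] int2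
      by (simp add: A2_def eq R.M1.prob_space)
    finally show ?thesis by simp
  qed
  \<comment> \<open>The scale is chosen so that \<open>(fst z / s1) ^ (2 * k1)\<close> has mean 1
    under \<rho>; likewise for \<open>s2\<close>.\<close>
  define s1 where "s1 = A1 powr (1 / (2 * real k1))"
  define s2 where "s2 = A2 powr (1 / (2 * real k2))"
  have s_pos: "0 < s1" "0 < s2" using A_pos by (auto simp: s1_def s2_def)
  have s_pow: "s1 ^ (2 * k1) = A1" "s2 ^ (2 * k2) = A2"
    using s_pos A_pos k by (simp_all add: s1_def s2_def powr_powr flip: powr_realpow)
  have ln_s: "ln s1 = ln A1 / (2 * real k1)" "ln s2 = ln A2 / (2 * real k2)"
    using A_pos by (simp_all add: s1_def s2_def ln_powr)
  define c where "c = exp 2 * fact (h1 + 1) * fact (h2 + 1) * s1 ^ (h1 + 1) * s2 ^ (h2 + 1)"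
  have c: "c > 0" using s_pos by (simp add: c_def)
  let ?g = "\<lambda>z. - ((fst z / s1) ^ (2 * k1)) - (snd z / s2) ^ (2 * k2)"
  have g_eq: "?g = (\<lambda>z. - (fst z ^ (2 * k1) / A1) - snd z ^ (2 * k2) / A2)"
    by (simp add: power_divide s_pow)
  have "(LINT z|\<rho>. ?g z) - ln c \<le> KL_divergence (exp 1) (prior h1 h2) \<rho>"
  proof (rule gibbs_variational[OF sigma_finite_prior prob_\<rho> _ sets_eq])
    show "integrable \<rho> ?g" unfolding g_eq using int1 int2 by simp
    show "(\<integral>\<^sup>+z. ennreal (exp (?g z)) \<partial>prior h1 h2) \<le> ennreal (exp (ln c))"
      using nn_integral_exp_prior_le[of s1 s2 "2 * k1" "2 * k2" h1 h2] s_pos k c by (simp add: c_def)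
  qed (use True in auto)
  moreover have "(LINT z|\<rho>. ?g z) = - 2"
    unfolding g_eq using int1 int2 A_pos by (simp flip: A1_def A2_def)
  moreover have "ln c = 2 + ln (fact (h1 + 1)) + ln (fact (h2 + 1))
      + (real h1 + 1) * ln s1 + (real h2 + 1) * ln s2"
    using s_pos unfolding c_def by (simp add: ln_mult ln_realpow algebra_simps del: fact_Suc power_Suc)
  \<comment> \<open>The left side is \<open>(h1 + 1) / (2 * k1)\<close> times \<open>ln A1\<close>.
    Since \<open>A1 \<le> 1\<close>, this logarithm is nonpositive, so lowering the exponent to
    \<open>lam\<close> raises the product.\<close>
  moreover have "(real h1 + 1) * ln s1 \<le> lam * ln A1"
    using mult_right_mono_neg[OF lam(2), of "ln A1"] A_pos A_le by (simp add: ln_s)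
  moreover have "(real h2 + 1) * ln s2 \<le> lam * ln A2"
    using mult_right_mono_neg[OF lam(3), of "ln A2"] A_pos A_le by (simp add: ln_s)
  moreover have "lam - lam * ln lam \<le> real n * (A1 * A2) - lam * ln (real n * (A1 * A2))"
    using A_pos n lam(1) by (intro diff_mult_ln_ge) auto
  moreover have "lam * ln (real n * (A1 * A2)) = lam * ln (real n) + lam * ln A1 + lam * ln A2"
    using A_pos n by (simp add: ln_mult algebra_simps)
  ultimately have "- (real n * (A1 * A2) + KL_divergence (exp 1) (prior h1 h2) \<rho>)
    \<le> 4 + ln (fact (h1 + 1)) + ln (fact (h2 + 1)) - lam + lam * ln lam - lam * ln (real n)"
    by linarith
  then show ?thesis unfolding Psi_def K KL_div_def using True by simp
qed

section \<open>The two bounds combined\<close>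

theorem theorem3p2:
  fixes k1 k2 h1 h2 :: nat and lam :: real
  assumes "k1 > 0" and "k2 > 0"
  defines "lam \<equiv> min ((real h1 + 1) / (2 * real k1)) ((real h2 + 1) / (2 * real k2))"
  shows "\<exists>C::real. \<forall>n::nat. n \<ge> 1 \<longrightarrow>
    \<bar>ELBO (K_nf k1 k2) (prior h1 h2) n (mean_field (prior h1 h2)) + ereal (lam * ln (real n))\<bar>
      \<le> ereal C"
proof -
  define U where "U = 4 + ln (fact (h1 + 1)) + ln (fact (h2 + 1)) - lam + lam * ln lam"
  have lam: "lam > 0" using assms by (simp add: lam_def add_pos_nonneg)
  \<comment> \<open>\<open>U\<close> comes from the upper bound, and 1 bounds the energy
    \<open>n * K\<close> of the trial measure in the lower bound.\<close>
  have "\<bar>ELBO (K_nf k1 k2) (prior h1 h2) n (mean_field (prior h1 h2)) + ereal (lam * ln (real n))\<bar>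
      \<le> ereal (max U 1)" if n: "n \<ge> 1" for n :: nat
  proof -
    let ?E = "ELBO (K_nf k1 k2) (prior h1 h2) n (mean_field (prior h1 h2))"
    have upper: "?E \<le> ereal (U - lam * ln (real n))"
      unfolding ELBO_def U_def
      by (intro SUP_least Psi_mean_field_le assms n lam) (simp_all add: lam_def)
    have lower: "ereal (- (lam * ln (real n)) - 1) \<le> ?E"
    proof -
      \<comment> \<open>The side \<open>n powr (- 1 / (2 * k))\<close> makes
        \<open>n * s ^ (2 * k)\<close> equal to 1, while \<open>(h + 1) * ln s\<close> becomes
        \<open>- (h + 1) / (2 * k) * ln n\<close>.\<close>
      have le: "real n powr (- 1 / (2 * real k)) \<le> 1" for k :: nat
        using powr_mono[of "- 1 / (2 * real k)" 0 "real n"] n by simp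
      have pow: "(real n powr (- 1 / (2 * real k))) ^ (2 * k) = 1 / real n" if "k > 0" for k :: nat
      proof -
        have "(real n powr (- 1 / (2 * real k))) ^ (2 * k) =
            real n powr (- 1 / (2 * real k) * real (2 * k))"
          using n by (subst powr_realpow[symmetric]) (auto simp only: powr_powr, simp)
        also have "- 1 / (2 * real k) * real (2 * k) = - 1" using that by simp
        finally show ?thesis by (simp add: powr_minus_divide)
      qed
      consider "lam = (real h1 + 1) / (2 * real k1)" | "lam = (real h2 + 1) / (2 * real k2)"
        unfolding lam_def min_def by metis
      then show ?thesis
      proof cases
        \<comment> \<open>Only the coordinate attaining the minimum is conditioned; the other side
          is 1 and costs no divergence.\<close>
        case 1
        then show ?thesis
          using ELBO_prior_ge[of "real n powr (- 1 / (2 * real k1))" 1 h1 h2 n k1 k2] n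
            pow[OF assms(1)] le[of k1]
          by (simp add: ln_powr)
      next
        case 2
        then show ?thesis
          using ELBO_prior_ge[of 1 "real n powr (- 1 / (2 * real k2))" h1 h2 n k1 k2] n
            pow[OF assms(2)] le[of k2]
          by (simp add: ln_powr)
      qed
    qed
    \<comment> \<open>Finite bounds on both sides exclude infinite values, so the rest is real
      arithmetic.\<close>
    from upper lower obtain e where e: "?E = ereal e" by (cases ?E) auto
    have "\<bar>e + lam * ln (real n)\<bar> \<le> max U 1" using upper lower unfolding e by simp
    then show ?thesis unfolding e by (simp del: ereal_max)
  qed
  then show ?thesis by blast
qed

end
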